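(* Let $D\subset\mathbb{C}$ be finite, $N$ a positive even integer, and $\gamma=(\gamma_{1},\ldots,\gamma_{r})$ a discrete path. Then for all $a_{1},\ldots,a_{k}\in D$, \[\Delta_{N,\gamma}(s(\gamma);e_{a_{1}}\cdots e_{a_{k}};t(\gamma))=(-1)^{k}\Delta_{N,\gamma^{-1}}(t(\gamma);e_{a_{k}}\cdots e_{a_{1}};s(\gamma)).\]
   Context: Let $\mathbb{Z}_{/N}=\{n/N\mid n\in\mathbb{Z}\}$ and let $\mathfrak{H}_{D}$ be the free non-commutative $\mathbb{Q}$-algebra on symbols $e_{z}$, $z\in D$. Endpoints: $B=(\mathbb{Z}_{/N}\setminus D)\sqcup((\mathbb{Z}_{/N}\cap D)\times\{1,\ldots,N\})$; for $p\in D\cap\mathbb{Z}_{/N}$ write $(p,+)=(p,N/2)$ and $(p,-)=(p,0)=(p,N)$. Pieces, with initial point $s$, final point $t$ and provision $S$: (i) positive straight piece $(x,y)\in(\mathbb{Z}_{/N})^{2}$, $x<y$, $(x,y)\cap D=\varnothing$; $s=(x,+)$ if $x\in D$, else $x$; $t=(y,-)$ if $y\in D$, else $y$; $S=\{xN+1,\ldots,yN-1\}$. (ii) negative straight piece $(x,y)$, $y<x$, with no point of $D$ in the open real interval $(y,x)$; $s=(x,-)$ if $x\in D$, else $x$; $t=(y,+)$ if $y\in D$, else $y$; $S=\{-xN+1,\ldots,-yN-1\}$. (iii) positive singular piece $(p,a,b,+)$ with $p\in D\cap\mathbb{Z}_{/N}$, integers $0\le a<b\le N$; $s=(p,a)$,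 $t=(p,b)$; $S=\{\theta^{+}_{a+1},\ldots,\theta^{+}_{b}\}$. (iv) negative singular piece $(p,a,b,-)$, same conditions; $s=(p,N-b)$, $t=(p,N-a)$; $S=\{\theta^{-}_{a+1},\ldots,\theta^{-}_{b}\}$. (v) trivial piece: an element $q$ of a copy of $B$, $s=t=q$, $S=\varnothing$. A discrete path is a tuple $\gamma=(\gamma_{1},\ldots,\gamma_{r})$, $r\ge1$, of pieces with $t(\gamma_{i})=s(\gamma_{i+1})$; $s(\gamma)=s(\gamma_{1})$, $t(\gamma)=t(\gamma_{r})$. The inverse is $\gamma^{-1}=(\gamma_{r}^{-1},\ldots,\gamma_{1}^{-1})$ where $(x,y)^{-1}=(y,x)$ for straight pieces, $(p,a,b,\sigma)^{-1}=(p,N-b,N-a,-\sigma)$ for singular pieces, and trivial pieces are their own inverses. The provision $S_{\gamma}=\bigsqcup_{i}S_{\gamma_{i}}\times\{i\}$ is totally ordered by $\le_{\gamma}$: earlier pieces first; within a straight piece by the integer order; within a singular piece by $\theta_{j}<\theta_{j+1}$. For $n=(\tilde n,i)\in S_{\gamma}$ and $c\in D$: $\omega_{c}(n)=1/(\tilde n-cN)$ if $\gamma_{i}$ is positive straight; $1/(\tilde n+cN)$ if negative straight; $\theta/N$ if $\gamma_{i}$ is positive singular with first entry $c$; $-\theta/N$ if negative singular with first entry $c$; $0$ otherwise. The discrete iterated integral is $\Delta_{N,\gamma}(s(\gamma);e_{a_{1}}\cdots e_{a_{k}};t(\gamma))=\sum_{n_{1}\le_{\gamma}\cdots\le_{\gamma}n_{k}\in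 S_{\gamma}}\prod_{i}\omega_{a_{i}}(n_{i})\in\mathbb{C}[\theta]$ (non-strict), equal to $1$ for the empty word; it depends only on the tuple of pieces and the word (the endpoint arguments are notation), and the same formula is used for $\gamma^{-1}$. *)

theory Defs
  imports Complex_Main "HOL-Computational_Algebra.Polynomial"
begin

definition frac_ints :: "nat \<Rightarrow> real set" where
  "frac_ints N = {of_int n / of_nat N | n :: int. True}"

text \<open>\<open>Tangential p j\<close> stands for the pair \<open>(p, j)\<close> with \<open>j\<close> in \<open>{1..N}\<close>; arbitrary indices
  \<open>0 \<le> j \<le> N\<close> are normalised by \<open>tangential\<close>, which identifies \<open>(p, 0)\<close> with \<open>(p, N)\<close>.\<close>

datatype endpoint = Regular real | Tangential real nat

definition tangential :: "nat \<Rightarrow> real \<Rightarrow> nat \<Rightarrow> endpoint" where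
  "tangential N p j = Tangential p (if j = 0 then N else j)"

definition endpoints :: "complex set \<Rightarrow> nat \<Rightarrow> endpoint set" where
  "endpoints D N =
     {Regular x | x. x \<in> frac_ints N \<and> complex_of_real x \<notin> D} \<union>
     {Tangential p j | p j. p \<in> frac_ints N \<and> complex_of_real p \<in> D \<and> j \<in> {1..N}}"

definition plus_end :: "complex set \<Rightarrow> nat \<Rightarrow> real \<Rightarrow> endpoint" where
  "plus_end D N x = (if complex_of_real x \<in> D then tangential N x (N div 2) else Regular x)"

definition minus_end :: "complex set \<Rightarrow> nat \<Rightarrow> real \<Rightarrow> endpoint" where
  "minus_end D N x = (if complex_of_real x \<in> D then tangential N x 0 else Regular x)"

datatype orientation = Pos | Neg

fun opposite :: "orientation \<Rightarrow> orientation" where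
  "opposite Pos = Neg"
| "opposite Neg = Pos"

text \<open>A straight piece \<open>Straight x y\<close> is positive if \<open>x < y\<close> and negative if \<open>y < x\<close>.\<close>

datatype piece =
    Straight real real
  | Singular real nat nat orientation
  | Trivial endpoint

fun is_piece :: "complex set \<Rightarrow> nat \<Rightarrow> piece \<Rightarrow> bool" where
  "is_piece D N (Straight x y) \<longleftrightarrow>
     x \<in> frac_ints N \<and> y \<in> frac_ints N \<and>
     (x < y \<and> complex_of_real ` {x<..<y} \<inter> D = {} \<or>
      y < x \<and> complex_of_real ` {y<..<x} \<inter> D = {})"
| "is_piece D N (Singular p a b \<sigma>) \<longleftrightarrow>
     p \<in> frac_ints N \<and> complex_of_real p \<in> D \<and> a < b \<and> b \<le> N"
| "is_piece D N (Trivial q) \<longleftrightarrow> q \<in> endpoints D N"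

fun piece_source :: "complex set \<Rightarrow> nat \<Rightarrow> piece \<Rightarrow> endpoint" where
  "piece_source D N (Straight x y) = (if x < y then plus_end D N x else minus_end D N x)"
| "piece_source D N (Singular p a b Pos) = tangential N p a"
| "piece_source D N (Singular p a b Neg) = tangential N p (N - b)"
| "piece_source D N (Trivial q) = q"

fun piece_target :: "complex set \<Rightarrow> nat \<Rightarrow> piece \<Rightarrow> endpoint" where
  "piece_target D N (Straight x y) = (if x < y then minus_end D N y else plus_end D N y)"
| "piece_target D N (Singular p a b Pos) = tangential N p b"
| "piece_target D N (Singular p a b Neg) = tangential N p (N - a)"
| "piece_target D N (Trivial q) = q"

definition discrete_path :: "complex set \<Rightarrow> nat \<Rightarrow> piece list \<Rightarrow> bool" where
  "discrete_path D N \<gamma> \<longleftrightarrow>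
     \<gamma> \<noteq> [] \<and> (\<forall>g \<in> set \<gamma>. is_piece D N g) \<and>
     (\<forall>i. Suc i < length \<gamma> \<longrightarrow> piece_target D N (\<gamma> ! i) = piece_source D N (\<gamma> ! Suc i))"

text \<open>With the above conventions a singular piece and its inverse have the same source and the same
  target, so the inverse of a discrete path need not satisfy \<^const>\<open>discrete_path\<close>; the integral
  below depends only on the list of pieces.\<close>

fun piece_inverse :: "nat \<Rightarrow> piece \<Rightarrow> piece" where
  "piece_inverse N (Straight x y) = Straight y x"
| "piece_inverse N (Singular p a b \<sigma>) = Singular p (N - b) (N - a) (opposite \<sigma>)"
| "piece_inverse N (Trivial q) = Trivial q"

definition path_inverse :: "nat \<Rightarrow> piece list \<Rightarrow> piece list" where
  "path_inverse N \<gamma> = rev (map (piece_inverse N) \<gamma>)"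

text \<open>\<open>Theta \<sigma> j\<close> is the formal symbol written \<open>\<theta>\<^sub>j\<close> with superscript \<open>\<sigma>\<close>.\<close>

datatype mark = Num int | Theta orientation nat

fun piece_provision :: "nat \<Rightarrow> piece \<Rightarrow> mark set" where
  "piece_provision N (Straight x y) =
     (if x < y
      then Num ` {n. x * of_nat N + 1 \<le> of_int n \<and> of_int n \<le> y * of_nat N - 1}
      else Num ` {n. - x * of_nat N + 1 \<le> of_int n \<and> of_int n \<le> - y * of_nat N - 1})"
| "piece_provision N (Singular p a b \<sigma>) = Theta \<sigma> ` {a+1..b}"
| "piece_provision N (Trivial q) = {}"

text \<open>Pieces of a path are indexed from \<open>0\<close>.\<close>

definition provision :: "nat \<Rightarrow> piece list \<Rightarrow> (mark \<times> nat) set" where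
  "provision N \<gamma> = {(n, i). i < length \<gamma> \<and> n \<in> piece_provision N (\<gamma> ! i)}"

fun mark_le :: "mark \<Rightarrow> mark \<Rightarrow> bool" where
  "mark_le (Num m) (Num n) \<longleftrightarrow> m \<le> n"
| "mark_le (Theta \<sigma> j) (Theta \<tau> k) \<longleftrightarrow> \<sigma> = \<tau> \<and> j \<le> k"
| "mark_le _ _ \<longleftrightarrow> False"

fun provision_le :: "mark \<times> nat \<Rightarrow> mark \<times> nat \<Rightarrow> bool" where
  "provision_le (m, i) (n, j) \<longleftrightarrow> i < j \<or> i = j \<and> mark_le m n"

text \<open>The ring \<open>\<complex>[\<theta>]\<close> is \<^typ>\<open>complex poly\<close> with \<open>\<theta> = [:0, 1:]\<close>.\<close>

fun piece_form :: "nat \<Rightarrow> piece \<Rightarrow> complex \<Rightarrow> mark \<Rightarrow> complex poly" where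
  "piece_form N (Straight x y) c (Num n) =
     (if x < y then [:1 / (of_int n - c * of_nat N):] else [:1 / (of_int n + c * of_nat N):])"
| "piece_form N (Singular p a b Pos) c (Theta _ _) =
     (if complex_of_real p = c then [:0, 1 / of_nat N:] else 0)"
| "piece_form N (Singular p a b Neg) c (Theta _ _) =
     (if complex_of_real p = c then - [:0, 1 / of_nat N:] else 0)"
| "piece_form _ _ _ _ = 0"

definition form :: "nat \<Rightarrow> piece list \<Rightarrow> complex \<Rightarrow> mark \<times> nat \<Rightarrow> complex poly" where
  "form N \<gamma> c n = piece_form N (\<gamma> ! snd n) c (fst n)"

text \<open>The word \<open>e\<^sub>a\<^sub>1 \<cdots> e\<^sub>a\<^sub>k\<close> is the list \<open>[a\<^sub>1, \<dots>, a\<^sub>k]\<close>.\<close>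

definition discrete_integral :: "nat \<Rightarrow> piece list \<Rightarrow> complex list \<Rightarrow> complex poly" where
  "discrete_integral N \<gamma> w =
     (\<Sum>ns \<in> {ns. length ns = length w \<and> set ns \<subseteq> provision N \<gamma> \<and> sorted_wrt provision_le ns}.
        \<Prod>i<length w. form N \<gamma> (w ! i) (ns ! i))"

end

theory Submission imports Defs begin

text \<open>Reversing a path reverses the order of its provision: the marks of a straight piece are
  negated, and \<open>\<theta>\<^sub>j\<close> becomes \<open>\<theta>\<^sub>N\<^sub>+\<^sub>1\<^sub>-\<^sub>j\<close> with the opposite orientation. This order-reversing
  bijection changes the sign of every form, so reading a weakly increasing tuple backwards matches
  the two sums term by term, each factor contributing \<open>-1\<close>.\<close>

text \<open>The \<open>+ 1\<close> is there because indices start at 1: the range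
  \<open>{a+1..b}\<close> is reflected onto \<open>{N-b+1..N-a}\<close>, which is the range of the
  inverse singular piece.\<close>

fun mark_inverse :: "nat \<Rightarrow> mark \<Rightarrow> mark" where
  "mark_inverse N (Num n) = Num (- n)"
| "mark_inverse N (Theta \<sigma> j) = Theta (opposite \<sigma>) (N + 1 - j)"

definition provision_inverse :: "nat \<Rightarrow> piece list \<Rightarrow> mark \<times> nat \<Rightarrow> mark \<times> nat" where
  "provision_inverse N \<gamma> n = (mark_inverse N (fst n), length \<gamma> - Suc (snd n))"

lemma opposite_opposite [simp]: "opposite (opposite \<sigma>) = \<sigma>"
  by (cases \<sigma>) auto

lemma opposite_eq_iff [simp]: "opposite \<sigma> = opposite \<tau> \<longleftrightarrow> \<sigma> = \<tau>"
  by (metis opposite_opposite)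

lemma is_piece_inverse:
  assumes "is_piece D N g"
  shows "is_piece D N (piece_inverse N g)"
  using assms by (cases g) auto

lemma piece_inverse_inverse:
  assumes "is_piece D N g"
  shows "piece_inverse N (piece_inverse N g) = g"
  using assms by (cases g) auto

lemma mark_inverse_in_piece_provision:
  assumes "is_piece D N g" "m \<in> piece_provision N g"
  shows "mark_inverse N m \<in> piece_provision N (piece_inverse N g)"
  using assms by (cases g; auto intro!: imageI; arith)

text \<open>Membership bounds the index of a \<open>Theta\<close> mark by \<open>b \<le> N\<close>,
  so the truncated subtraction \<open>N + 1 - j\<close> undoes itself.\<close>

lemma mark_inverse_inverse:
  assumes "is_piece D N g" "m \<in> piece_provision N g"
  shows "mark_inverse N (mark_inverse N m) = m"
  using assms by (cases g) (auto split: if_splits)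

lemma mark_le_mark_inverse:
  assumes "is_piece D N g" "m \<in> piece_provision N g" "n \<in> piece_provision N g" "mark_le m n"
  shows "mark_le (mark_inverse N n) (mark_inverse N m)"
  using assms by (cases g) (auto split: if_splits)

text \<open>On straight pieces the denominator changes sign, as
  \<open>-n + c N = -(n - c N)\<close>; a vanishing one is covered by the convention
  \<open>1 / 0 = 0\<close>. On singular pieces the point \<open>p\<close> is kept and the opposite
  orientation carries the opposite sign.\<close>

lemma piece_form_inverse:
  assumes "is_piece D N g" "m \<in> piece_provision N g"
  shows "piece_form N (piece_inverse N g) c (mark_inverse N m) = - piece_form N g c m"
proof (cases g)
  case (Straight x y)
  have neg: "1 / (- u) = - (1 / u)" for u :: complex
    by simp
  show ?thesis
    using assms neg[of "of_int n - c * of_nat N" for n] neg[of "of_int n + c * of_nat N" for n]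
    by (auto simp: Straight algebra_simps split: if_splits)
next
  case (Singular p a b \<sigma>)
  then show ?thesis
    using assms by (cases \<sigma>) auto
next
  case (Trivial q)
  then show ?thesis
    using assms by simp
qed

lemma length_path_inverse [simp]: "length (path_inverse N \<gamma>) = length \<gamma>"
  by (simp add: path_inverse_def)

lemma path_inverse_nth:
  assumes "i < length \<gamma>"
  shows "path_inverse N \<gamma> ! (length \<gamma> - Suc i) = piece_inverse N (\<gamma> ! i)"
  using assms by (simp add: path_inverse_def rev_nth)

context
  fixes D :: "complex set" and N :: nat and \<gamma> :: "piece list"
  assumes pieces: "\<forall>g \<in> set \<gamma>. is_piece D N g"
begin

text \<open>Allows the lemmas of this context to be applied to the inverse path as well, even where
  it violates \<open>discrete_path\<close>.\<close>

lemma path_inverse_pieces: "\<forall>g \<in> set (path_inverse N \<gamma>). is_piece D N g"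
  using pieces by (auto simp: path_inverse_def is_piece_inverse)

lemma path_inverse_inverse: "path_inverse N (path_inverse N \<gamma>) = \<gamma>"
  using pieces by (auto simp: path_inverse_def rev_map piece_inverse_inverse intro!: map_idI)

lemma provision_inverse_in_provision:
  assumes "n \<in> provision N \<gamma>"
  shows "provision_inverse N \<gamma> n \<in> provision N (path_inverse N \<gamma>)"
  using assms pieces
  by (force simp: provision_def provision_inverse_def path_inverse_nth
      intro!: mark_inverse_in_piece_provision)

lemma provision_inverse_inverse:
  assumes "n \<in> provision N \<gamma>"
  shows "provision_inverse N \<gamma> (provision_inverse N \<gamma> n) = n"
  using assms pieces
  by (auto simp: provision_def provision_inverse_def intro!: mark_inverse_inverse)

text \<open>Sending position \<open>i\<close> to \<open>length \<gamma> - Suc i\<close> reverses the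
  order of distinct pieces; inside one piece the marks are reversed by
  \<open>mark_le_mark_inverse\<close>.\<close>

lemma provision_le_provision_inverse:
  assumes "m \<in> provision N \<gamma>" "n \<in> provision N \<gamma>" "provision_le m n"
  shows "provision_le (provision_inverse N \<gamma> n) (provision_inverse N \<gamma> m)"
proof -
  obtain m' i n' j where "m = (m', i)" "n = (n', j)"
    by (metis surj_pair)
  then show ?thesis
    using assms pieces mark_le_mark_inverse[of D N "\<gamma> ! i" m' n']
    by (auto simp: provision_def provision_inverse_def)
qed

lemma form_provision_inverse:
  assumes "n \<in> provision N \<gamma>"
  shows "form N (path_inverse N \<gamma>) c (provision_inverse N \<gamma> n) = - form N \<gamma> c n"
  using assms pieces
  by (auto simp: provision_def provision_inverse_def form_def path_inverse_nth
      intro!: piece_form_inverse)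

text \<open>Two reversals cancel: the map is antitone, and \<open>rev\<close> restores the
  increasing order.\<close>

lemma sorted_wrt_provision_inverse:
  assumes "set ns \<subseteq> provision N \<gamma>" "sorted_wrt provision_le ns"
  shows "sorted_wrt provision_le (rev (map (provision_inverse N \<gamma>) ns))"
proof -
  have "sorted_wrt (\<lambda>m n. provision_le (provision_inverse N \<gamma> n) (provision_inverse N \<gamma> m)) ns"
    using assms(2) by (rule sorted_wrt_mono_rel[rotated])
      (use assms(1) provision_le_provision_inverse in blast)
  then show ?thesis
    by (simp add: sorted_wrt_rev sorted_wrt_map)
qed

lemma rev_map_provision_inverse_inverse:
  assumes "set ns \<subseteq> provision N \<gamma>"
  shows "rev (map (provision_inverse N \<gamma>) (rev (map (provision_inverse N \<gamma>) ns))) = ns"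
  using assms by (auto simp: rev_map provision_inverse_inverse intro!: map_idI)

lemma prod_form_provision_inverse:
  assumes "set ns \<subseteq> provision N \<gamma>" "length ns = length w"
  shows "(\<Prod>i<length w. form N \<gamma> (w ! i) (ns ! i)) =
    (-1) ^ length w * (\<Prod>i<length w. form N (path_inverse N \<gamma>) (rev w ! i)
      (rev (map (provision_inverse N \<gamma>) ns) ! i))"
proof -
  let ?k = "length w"
  have "(\<Prod>i<?k. form N (path_inverse N \<gamma>) (rev w ! i) (rev (map (provision_inverse N \<gamma>) ns) ! i))
    = (\<Prod>i<?k. - form N \<gamma> (w ! (?k - Suc i)) (ns ! (?k - Suc i)))"
  proof (rule prod.cong[OF refl])
    fix i assume i: "i \<in> {..<?k}"
    then have "ns ! (?k - Suc i) \<in> set ns"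
      using assms(2) by (intro nth_mem) simp
    then have "ns ! (?k - Suc i) \<in> provision N \<gamma>"
      using assms(1) by blast
    then show "form N (path_inverse N \<gamma>) (rev w ! i) (rev (map (provision_inverse N \<gamma>) ns) ! i)
      = - form N \<gamma> (w ! (?k - Suc i)) (ns ! (?k - Suc i))"
      using i assms(2) by (simp add: rev_nth form_provision_inverse)
  qed
  \<comment> \<open>Reading both the word and the tuple backwards only permutes the factors.\<close>
  also have "\<dots> = (\<Prod>i<?k. - form N \<gamma> (w ! i) (ns ! i))"
    by (rule prod.nat_diff_reindex)
  also have "\<dots> = (-1) ^ ?k * (\<Prod>i<?k. form N \<gamma> (w ! i) (ns ! i))"
    by (simp add: prod_uminus)
  \<comment> \<open>The sign can change sides because \<open>(-1) ^ ?k\<close> squares to 1.\<close>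
  finally show ?thesis
    by (simp flip: mult.assoc power_mult_distrib)
qed

end

theorem mainTheorem3:
  fixes D :: "complex set" and N :: nat and \<gamma> :: "piece list" and w :: "complex list"
  assumes "finite D"
    and "N > 0"
    and "even N"
    and "discrete_path D N \<gamma>"
    and "set w \<subseteq> D"
  shows "discrete_integral N \<gamma> w =
         (-1) ^ length w * discrete_integral N (path_inverse N \<gamma>) (rev w)"
proof -
  have pieces: "\<forall>g \<in> set \<gamma>. is_piece D N g"
    using assms(4) by (simp add: discrete_path_def)
  note pieces' = path_inverse_pieces[OF pieces]
  let ?\<gamma>' = "path_inverse N \<gamma>"
  let ?f = "\<lambda>ns. rev (map (provision_inverse N \<gamma>) ns)"
  \<comment> \<open>The path enters this map only through its length, which inversion
    preserves.\<close>
  have same: "provision_inverse N ?\<gamma>' = provision_inverse N \<gamma>"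
    by (simp add: provision_inverse_def fun_eq_iff)
  have image: "set (?f ns) \<subseteq> provision N ?\<gamma>'" if "set ns \<subseteq> provision N \<gamma>" for ns
    using that provision_inverse_in_provision[OF pieces] by auto
  have image': "set (?f ns) \<subseteq> provision N \<gamma>" if "set ns \<subseteq> provision N ?\<gamma>'" for ns
    using that provision_inverse_in_provision[OF pieces']
    unfolding same path_inverse_inverse[OF pieces] by auto
  show ?thesis
    unfolding discrete_integral_def sum_distrib_left
  \<comment> \<open>By \<open>same\<close>, one formula serves as the bijection and as its inverse.
    Cases 1 and 2 concern tuples on the path, cases 3 and 4 those on its inverse, and case 5
    compares the summands.\<close>
  proof (rule sum.reindex_bij_witness[where i = ?f and j = ?f], goal_cases)
    case (1 ns)
    then show ?case
      by (intro rev_map_provision_inverse_inverse[OF pieces]) simp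
  next
    case (2 ns)
    then show ?case
      using image sorted_wrt_provision_inverse[OF pieces] by simp
  next
    case (3 ns)
    then show ?case
      using rev_map_provision_inverse_inverse[OF pieces'] unfolding same by blast
  next
    case (4 ns)
    then show ?case
      using image' sorted_wrt_provision_inverse[OF pieces'] unfolding same by simp
  next
    case (5 ns)
    then show ?case
      using prod_form_provision_inverse[OF pieces, of ns w] by simp
  qed
qed

end
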